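(* Let $G=(V,E,w)$ be a finite vertex-weighted graph with nonnegative vertex weights and maximum degree $\Delta$. For any $\varepsilon\in(0,0.1]$ and integer $k\in\mathbb{Z}_+$, if $k\ge\max\left\{\frac{\chi(G)}{\varepsilon},2\Delta\right\}$ and $\max_{v\in V}w_v\le \varepsilon\frac{w(V)}{k}$, then there exists a $(1+7\varepsilon)$-EQ1 $k$-coloring of $G$, where $\chi(G)$ denotes the chromatic number of $G$.
   Context: For $S\subseteq V$, $w(S)=\sum_{v\in S}w_v$. A $k$-coloring of $G$ is a partition $(C_1,\dots,C_k)$ of $V$ into $k$ (possibly empty) sets, each of which is an independent set of $G$. For $\alpha\ge 1$, a coloring $(C_1,\dots,C_k)$ is $\alpha$-EQ1 if for every $i,j\in[k]$ with $C_i\neq\emptyset$ there exists a vertex $\bar v\in C_i$ such that $w(C_i\setminus\{\bar v\})\le \alpha\, w(C_j)$. *)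

theory Defs
  imports Complex_Main "HOL-Library.Disjoint_Sets" "Graph_Theory.Digraph"
begin

text \<open>
  Finite simple undirected graphs are given by the locale \<^locale>\<open>graph\<close>: finite symmetric
  digraphs without loops and multiple arcs. Each undirected edge is thus a pair of opposite arcs,
  and the degree of a vertex is its out-degree.
\<close>

definition max_degree :: "('a, 'b) pre_digraph \<Rightarrow> nat" where
  \<comment> \<open>inserting 0 only matters for the graph without vertices\<close>
  "max_degree G = Max (insert 0 (out_degree G ` verts G))"

definition independent_set :: "('a, 'b) pre_digraph \<Rightarrow> 'a set \<Rightarrow> bool" where
  "independent_set G S \<longleftrightarrow>
     S \<subseteq> verts G \<and> (\<forall>u\<in>S. \<forall>v\<in>S. (u, v) \<notin> arcs_ends G)"

definition k_coloring :: "('a, 'b) pre_digraph \<Rightarrow> nat \<Rightarrow> (nat \<Rightarrow> 'a set) \<Rightarrow> bool" where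
  "k_coloring G k C \<longleftrightarrow>
     disjoint_family_on C {1..k} \<and> (\<Union>i\<in>{1..k}. C i) = verts G \<and>
     (\<forall>i\<in>{1..k}. independent_set G (C i))"

definition chromatic_number :: "('a, 'b) pre_digraph \<Rightarrow> nat" where
  "chromatic_number G = (LEAST k. \<exists>C. k_coloring G k C)"

definition EQ1 :: "('a \<Rightarrow> real) \<Rightarrow> real \<Rightarrow> nat \<Rightarrow> (nat \<Rightarrow> 'a set) \<Rightarrow> bool" where
  "EQ1 w \<alpha> k C \<longleftrightarrow>
     (\<forall>i\<in>{1..k}. \<forall>j\<in>{1..k}. C i \<noteq> {} \<longrightarrow>
        (\<exists>v\<in>C i. sum w (C i - {v}) \<le> \<alpha> * sum w (C j)))"

lemma ex_k_coloring:
  assumes "graph G"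
  shows "\<exists>k C. k_coloring G k C"
proof -
  interpret graph G by fact
  obtain f where f: "bij_betw f {1..card (verts G)} (verts G)"
    using ex_bij_betw_nat_finite_1[OF finite_verts] by blast
  have "independent_set G {f i}" if "i \<in> {1..card (verts G)}" for i
    using bij_betwE[OF f] that adj_not_same unfolding independent_set_def by blast
  moreover have "disjoint_family_on (\<lambda>i. {f i}) {1..card (verts G)}"
    using bij_betw_imp_inj_on[OF f] unfolding disjoint_family_on_def inj_on_def by blast
  moreover have "(\<Union>i\<in>{1..card (verts G)}. {f i}) = verts G"
    using bij_betw_imp_surj_on[OF f] by blast
  ultimately have "k_coloring G (card (verts G)) (\<lambda>i. {f i})"
    unfolding k_coloring_def by blast
  then show ?thesis by blast
qed

end

theory Submission
  imports Defs
begin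

text \<open>
  Let \<open>\<mu> = w(V)/k\<close> and \<open>t = \<mu>(1 - \<epsilon>)/(1 + \<epsilon>)\<close>. As long as fewer than \<open>k\<close> pieces of weight between
  \<open>t\<close> and \<open>t + \<epsilon>\<mu>\<close> have been cut out of an optimal coloring, the remaining weight exceeds
  \<open>\<chi>(G) t\<close>, so some color class still contains weight \<open>t\<close> and another piece can be cut from it.
  The vertices outside the \<open>k\<close> pieces are then added one at a time. At least \<open>k/2\<close> classes contain
  no neighbor of the vertex, and since every class weighs at least \<open>t\<close>, one of these weighs at most
  \<open>2\<mu> - t\<close>. All final weights lie between \<open>t\<close> and \<open>2\<mu> - t + \<epsilon>\<mu> \<le> (1 + 7\<epsilon>) t\<close>.
\<close>

lemma exists_subset_sum_between:
  fixes w :: "'a \<Rightarrow> 'b :: {linorder, ordered_comm_monoid_add}"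
  assumes "finite A" "\<And>v. v \<in> A \<Longrightarrow> w v \<le> m" "0 \<le> t" "0 \<le> m" "t \<le> sum w A"
  shows "\<exists>B\<subseteq>A. sum w B \<in> {t..t + m}"
  using assms
proof (induction A rule: finite_induct)
  case empty
  then show ?case by (auto intro: add_nonneg_nonneg)
next
  case (insert x A)
  show ?case
  proof (cases "t \<le> sum w A")
    case True
    then show ?thesis using insert by (metis insertCI subset_insertI2)
  next
    case False
    then have "w x + sum w A \<le> m + t"
      using insert.prems(1) by (intro add_mono) auto
    then have "sum w (insert x A) \<le> t + m"
      using insert.hyps by (simp add: add.commute)
    with insert.prems show ?thesis by auto
  qed
qed

lemma exists_greater_if_card_mult_less_sum:
  fixes f :: "'i \<Rightarrow> 'b :: linordered_semiring_1"
  assumes "of_nat (card I) * t < sum f I"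
  shows "\<exists>i\<in>I. t < f i"
proof (rule ccontr)
  assume "\<not> ?thesis"
  then have "sum f I \<le> of_nat (card I) * t"
    by (intro sum_bounded_above) (simp add: not_less)
  with assms show False by simp
qed

lemma exists_le_twice_mean:
  fixes f :: "'i \<Rightarrow> 'b :: linordered_field"
  assumes "finite I" "J \<subseteq> I" "J \<noteq> {}" and half: "card I \<le> 2 * card J"
    and nonneg: "\<And>i. i \<in> I \<Longrightarrow> 0 \<le> f i"
  shows "\<exists>j\<in>J. f j \<le> 2 * (sum f I / of_nat (card I))"
proof -
  have "finite J" using assms(1,2) by (rule rev_finite_subset)
  then obtain j where j: "j \<in> J" "\<And>i. i \<in> J \<Longrightarrow> f j \<le> f i"
    using ex_is_arg_min_if_finite[of J f] \<open>J \<noteq> {}\<close> by (auto simp: is_arg_min_linorder)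
  have "of_nat (card I) * f j \<le> of_nat (2 * card J) * f j"
    using half nonneg j(1) \<open>J \<subseteq> I\<close> by (intro mult_right_mono of_nat_mono) auto
  also have "\<dots> \<le> 2 * sum f J"
    using sum_bounded_below[of J "f j" f] j(2) by simp
  also have "\<dots> \<le> 2 * sum f I"
    using assms(1,2) nonneg by (auto intro: sum_mono2)
  finally have "of_nat (card I) * f j \<le> 2 * sum f I" .
  moreover have "0 < card I"
    using assms(1-3) by (auto simp: card_gt_0_iff)
  ultimately have "f j \<le> 2 * (sum f I / of_nat (card I))"
    by (simp add: field_simps)
  with j(1) show ?thesis ..
qed

lemma independent_set_subset:
  "independent_set G S \<Longrightarrow> T \<subseteq> S \<Longrightarrow> independent_set G T"
  unfolding independent_set_def by blast

definition partial_coloring :: "('a, 'b) pre_digraph \<Rightarrow> 'i set \<Rightarrow> ('i \<Rightarrow> 'a set) \<Rightarrow> bool" where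
  "partial_coloring G I C \<longleftrightarrow> disjoint_family_on C I \<and> (\<forall>i\<in>I. independent_set G (C i))"

lemma k_coloring_iff_partial_coloring:
  "k_coloring G k C \<longleftrightarrow> partial_coloring G {1..k} C \<and> (\<Union>i\<in>{1..k}. C i) = verts G"
  unfolding k_coloring_def partial_coloring_def by blast

lemma partial_coloring_UN_subset_verts:
  "partial_coloring G I C \<Longrightarrow> (\<Union>i\<in>I. C i) \<subseteq> verts G"
  unfolding partial_coloring_def independent_set_def by blast

lemma partial_coloring_mono:
  "partial_coloring G I C \<Longrightarrow> (\<And>i. i \<in> I \<Longrightarrow> D i \<subseteq> C i) \<Longrightarrow> partial_coloring G I D"
  unfolding partial_coloring_def disjoint_family_on_def
  by (blast intro: independent_set_subset)

lemma partial_coloring_fun_upd: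
  assumes "partial_coloring G (I - {i}) C" "independent_set G B" "B \<inter> (\<Union>j\<in>I - {i}. C j) = {}"
  shows "partial_coloring G (insert i I) (C(i := B))"
proof -
  have "disjoint_family_on (C(i := B)) (I - {i})"
    using assms(1) by (simp add: partial_coloring_def disjoint_family_on_def)
  moreover have "(C(i := B)) i \<inter> (\<Union>j\<in>I - {i}. (C(i := B)) j) = {}"
    using assms(3) by simp
  ultimately have "disjoint_family_on (C(i := B)) (insert i (I - {i}))"
    by (subst disjoint_family_on_insert) auto
  with assms(1,2) show ?thesis
    by (simp add: partial_coloring_def)
qed

lemma sum_UN_partial_coloring:
  assumes "finite (verts G)" "finite I" "partial_coloring G I C"
  shows "sum w (\<Union>i\<in>I. C i) = (\<Sum>i\<in>I. sum w (C i))"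
proof (rule sum.UNION_disjoint)
  show "\<forall>i\<in>I. finite (C i)"
    using partial_coloring_UN_subset_verts[OF assms(3)] assms(1) by (auto intro: finite_subset)
  show "\<forall>i\<in>I. \<forall>j\<in>I. i \<noteq> j \<longrightarrow> C i \<inter> C j = {}"
    using assms(3) by (simp add: partial_coloring_def disjoint_family_on_def)
qed fact

lemma exists_independent_subset_weight_between:
  fixes w :: "'a \<Rightarrow> real" and m t :: real
  assumes "finite (verts G)" "k_coloring G c C" "R \<subseteq> verts G"
    and "\<And>v. v \<in> R \<Longrightarrow> w v \<le> m" "0 \<le> t" "0 \<le> m" and heavy: "c * t < sum w R"
  shows "\<exists>B\<subseteq>R. independent_set G B \<and> sum w B \<in> {t..t + m}"
proof -
  have C: "partial_coloring G {1..c} C" "(\<Union>j\<in>{1..c}. C j) = verts G"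
    using assms(2) by (auto simp: k_coloring_iff_partial_coloring)
  have parts: "partial_coloring G {1..c} (\<lambda>j. R \<inter> C j)"
    using C(1) by (rule partial_coloring_mono) simp
  have "(\<Union>j\<in>{1..c}. R \<inter> C j) = R"
    using C(2) \<open>R \<subseteq> verts G\<close> by blast
  then have "sum w R = (\<Sum>j\<in>{1..c}. sum w (R \<inter> C j))"
    using sum_UN_partial_coloring[OF assms(1) _ parts, of w] by simp
  with heavy have "card {1..c} * t < (\<Sum>j\<in>{1..c}. sum w (R \<inter> C j))"
    by simp
  from exists_greater_if_card_mult_less_sum[OF this]
  obtain j where j: "j \<in> {1..c}" "t < sum w (R \<inter> C j)"
    by blast
  have "finite R" using assms(3,1) by (rule finite_subset)
  then have "\<exists>B\<subseteq>R \<inter> C j. sum w B \<in> {t..t + m}"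
    using assms(4-6) j(2) by (intro exists_subset_sum_between) auto
  moreover have "independent_set G (C j)"
    using C(1) j(1) by (simp add: partial_coloring_def)
  ultimately show ?thesis
    using independent_set_subset by blast
qed

lemma exists_partial_coloring_weights_between:
  fixes w :: "'a \<Rightarrow> real" and m t :: real
  assumes fin: "finite (verts G)" and col: "k_coloring G c C"
    and le_m: "\<And>v. v \<in> verts G \<Longrightarrow> w v \<le> m" and "0 < t" "0 \<le> m"
    and "finite I" and total: "card I * (t + m) + c * t \<le> sum w (verts G)"
  shows "\<exists>D. partial_coloring G I D \<and> (\<forall>i\<in>I. sum w (D i) \<in> {t..t + m})"
  using \<open>finite I\<close> total
proof (induction I rule: finite_induct)
  case empty
  show ?case by (simp add: partial_coloring_def disjoint_family_on_def)
next
  case (insert i I)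
  have budget: "card I * (t + m) + c * t + (t + m) \<le> sum w (verts G)"
    using insert.hyps insert.prems by (simp add: algebra_simps)
  with insert.IH \<open>0 < t\<close> \<open>0 \<le> m\<close> obtain D
    where D: "partial_coloring G I D" "\<And>j. j \<in> I \<Longrightarrow> sum w (D j) \<in> {t..t + m}"
    by auto
  define R where "R = verts G - (\<Union>j\<in>I. D j)"
  have "(\<Sum>j\<in>I. sum w (D j)) \<le> card I * (t + m)"
    using D(2) by (intro sum_bounded_above) auto
  moreover have "sum w R = sum w (verts G) - (\<Sum>j\<in>I. sum w (D j))"
    unfolding R_def
    by (simp only: sum_diff[OF fin partial_coloring_UN_subset_verts[OF D(1)]]
        sum_UN_partial_coloring[OF fin insert.hyps(1) D(1)])
  ultimately have "c * t < sum w R"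
    using budget \<open>0 < t\<close> \<open>0 \<le> m\<close> by linarith
  then obtain B where B: "B \<subseteq> R" "independent_set G B" "sum w B \<in> {t..t + m}"
    using exists_independent_subset_weight_between[OF fin col, of R w m t] le_m \<open>0 < t\<close> \<open>0 \<le> m\<close>
    by (auto simp: R_def)
  have "partial_coloring G (insert i I) (D(i := B))"
    using D(1) B insert.hyps(2) by (intro partial_coloring_fun_upd) (auto simp: R_def)
  moreover have "\<forall>j\<in>insert i I. sum w ((D(i := B)) j) \<in> {t..t + m}"
    using D(2) B(3) by simp
  ultimately show ?case by blast
qed

definition classes_adjacent_to ::
  "('a, 'b) pre_digraph \<Rightarrow> 'i set \<Rightarrow> ('i \<Rightarrow> 'a set) \<Rightarrow> 'a \<Rightarrow> 'i set" where
  "classes_adjacent_to G I C v = {i \<in> I. \<exists>u\<in>C i. (v, u) \<in> arcs_ends G}"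

lemma (in fin_digraph) card_classes_adjacent_to_le_max_degree:
  assumes "disjoint_family_on C I" and "v \<in> verts G"
  shows "card (classes_adjacent_to G I C v) \<le> max_degree G"
proof -
  let ?N = "head G ` out_arcs G v"
  obtain f where f: "\<And>i. i \<in> classes_adjacent_to G I C v \<Longrightarrow> f i \<in> C i \<and> (v, f i) \<in> arcs_ends G"
    using bchoice[of "classes_adjacent_to G I C v" "\<lambda>i u. u \<in> C i \<and> (v, u) \<in> arcs_ends G"]
    by (auto simp: classes_adjacent_to_def)
  have "inj_on f (classes_adjacent_to G I C v)"
  proof (rule inj_onI)
    fix i j
    assume ij: "i \<in> classes_adjacent_to G I C v" "j \<in> classes_adjacent_to G I C v" and "f i = f j"
    then have "f i \<in> C i \<inter> C j" using f[of i] f[of j] by simp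
    with ij show "i = j"
      using assms(1) unfolding disjoint_family_on_def classes_adjacent_to_def by blast
  qed
  moreover have "f ` classes_adjacent_to G I C v \<subseteq> ?N"
    using f by (force simp: arcs_ends_conv)
  ultimately have "card (classes_adjacent_to G I C v) \<le> card ?N"
    by (intro card_inj_on_le) auto
  also have "\<dots> \<le> out_degree G v"
    unfolding out_degree_def by (intro card_image_le finite_out_arcs)
  also have "\<dots> \<le> max_degree G"
    unfolding max_degree_def using assms(2) by (intro Max_ge) auto
  finally show ?thesis .
qed

lemma (in graph) independent_set_insert:
  assumes "independent_set G S" "v \<in> verts G" "\<And>u. u \<in> S \<Longrightarrow> (v, u) \<notin> arcs_ends G"
  shows "independent_set G (insert v S)"
  using assms arcs_ends_symmetric[OF sym_arcs] adj_not_same unfolding independent_set_def by blast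

lemma (in fin_digraph) exists_light_nonadjacent_class:
  fixes w :: "'a \<Rightarrow> real" and t :: real
  assumes nonneg: "\<And>v. v \<in> verts G \<Longrightarrow> 0 \<le> w v"
    and "finite I" "I \<noteq> {}" and deg: "2 * max_degree G \<le> card I"
    and C: "partial_coloring G I C" and ge_t: "\<And>i. i \<in> I \<Longrightarrow> t \<le> sum w (C i)"
    and "v \<in> verts G"
  shows "\<exists>j\<in>I - classes_adjacent_to G I C v. sum w (C j) \<le> 2 * (sum w (verts G) / card I) - t"
proof -
  let ?J = "I - classes_adjacent_to G I C v"
  let ?g = "\<lambda>i. sum w (C i) - t"
  have "0 < card I" using assms(2,3) by (simp add: card_gt_0_iff)
  have "card (classes_adjacent_to G I C v) \<le> max_degree G"
    using C \<open>v \<in> verts G\<close> by (simp add: card_classes_adjacent_to_le_max_degree partial_coloring_def)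
  moreover have "classes_adjacent_to G I C v \<subseteq> I"
    by (auto simp: classes_adjacent_to_def)
  ultimately have half: "card I \<le> 2 * card ?J"
    using deg \<open>finite I\<close> by (simp add: card_Diff_subset finite_subset)
  with \<open>0 < card I\<close> have "?J \<noteq> {}"
    by (metis card.empty mult_0_right not_le)
  then obtain j where j: "j \<in> ?J" "?g j \<le> 2 * (sum ?g I / card I)"
    using exists_le_twice_mean[OF \<open>finite I\<close> Diff_subset _ half, of ?g] ge_t by auto
  have "sum ?g I / card I = (\<Sum>i\<in>I. sum w (C i)) / card I - t"
    using \<open>0 < card I\<close> by (simp add: sum_subtractf field_simps)
  also have "\<dots> = sum w (\<Union>i\<in>I. C i) / card I - t"
    by (simp add: sum_UN_partial_coloring[OF finite_verts \<open>finite I\<close> C])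
  also have "\<dots> \<le> sum w (verts G) / card I - t"
    using partial_coloring_UN_subset_verts[OF C] nonneg
    by (intro diff_right_mono divide_right_mono sum_mono2) auto
  finally show ?thesis using j by (intro bexI[of _ j]) auto
qed

lemma (in graph) partial_coloring_extend_vertex:
  fixes w :: "'a \<Rightarrow> real" and m t u :: real
  assumes nonneg: "\<And>v. v \<in> verts G \<Longrightarrow> 0 \<le> w v" and le_m: "\<And>v. v \<in> verts G \<Longrightarrow> w v \<le> m"
    and "finite I" "I \<noteq> {}" and "2 * max_degree G \<le> card I"
    and C: "partial_coloring G I C"
    and weights: "\<And>i. i \<in> I \<Longrightarrow> sum w (C i) \<in> {t..u}"
    and u: "2 * (sum w (verts G) / card I) - t + m \<le> u"
    and v: "v \<in> verts G - (\<Union>i\<in>I. C i)"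
  obtains D where "partial_coloring G I D" "(\<Union>i\<in>I. D i) = insert v (\<Union>i\<in>I. C i)"
    "\<And>i. i \<in> I \<Longrightarrow> sum w (D i) \<in> {t..u}"
proof -
  obtain j where j: "j \<in> I" "j \<notin> classes_adjacent_to G I C v"
      "sum w (C j) \<le> 2 * (sum w (verts G) / card I) - t"
    using exists_light_nonadjacent_class[where w = w and t = t and v = v, OF nonneg assms(3-5) C]
      weights v by auto
  let ?D = "C(j := insert v (C j))"
  have "independent_set G (insert v (C j))"
    using C j(1,2) v
    by (intro independent_set_insert) (auto simp: partial_coloring_def classes_adjacent_to_def)
  moreover have "insert v (C j) \<inter> (\<Union>i\<in>I - {j}. C i) = {}"
    using C j(1) v unfolding partial_coloring_def disjoint_family_on_def by blast
  moreover have "partial_coloring G (I - {j}) C"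
    using C by (auto simp: partial_coloring_def disjoint_family_on_def)
  ultimately have "partial_coloring G I ?D"
    using partial_coloring_fun_upd[of G I j C] j(1) by (simp add: insert_absorb)
  moreover have "(\<Union>i\<in>I. ?D i) = insert v (\<Union>i\<in>I. C i)"
    using j(1) by (auto split: if_splits)
  moreover have "sum w (?D i) \<in> {t..u}" if "i \<in> I" for i
  proof -
    have "finite (C j)"
      using partial_coloring_UN_subset_verts[OF C] j(1)
      by (intro finite_subset[OF _ finite_verts]) blast
    then have "sum w (insert v (C j)) = w v + sum w (C j)"
      using j(1) v by (intro sum.insert) auto
    with weights[OF j(1)] weights[OF that] nonneg[of v] le_m[of v] j(3) u v
    show ?thesis by auto
  qed
  ultimately show thesis by (rule that)
qed

lemma (in graph) partial_coloring_extend: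
  fixes w :: "'a \<Rightarrow> real" and m t u :: real
  assumes "\<And>v. v \<in> verts G \<Longrightarrow> 0 \<le> w v" and "\<And>v. v \<in> verts G \<Longrightarrow> w v \<le> m"
    and "finite I" "I \<noteq> {}" and "2 * max_degree G \<le> card I"
    and "2 * (sum w (verts G) / card I) - t + m \<le> u"
    and "partial_coloring G I C" and "\<And>i. i \<in> I \<Longrightarrow> sum w (C i) \<in> {t..u}"
  shows "\<exists>D. partial_coloring G I D \<and> (\<Union>i\<in>I. D i) = verts G \<and> (\<forall>i\<in>I. sum w (D i) \<in> {t..u})"
  using assms(7,8)
proof (induction "verts G - (\<Union>i\<in>I. C i)" arbitrary: C rule: measure_induct_rule[of card])
  case less
  show ?case
  proof (cases "(\<Union>i\<in>I. C i) = verts G")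
    case True
    with less.prems show ?thesis by blast
  next
    case False
    then obtain v where v: "v \<in> verts G - (\<Union>i\<in>I. C i)"
      using partial_coloring_UN_subset_verts[OF less.prems(1)] by blast
    obtain D where D: "partial_coloring G I D" "(\<Union>i\<in>I. D i) = insert v (\<Union>i\<in>I. C i)"
        "\<And>i. i \<in> I \<Longrightarrow> sum w (D i) \<in> {t..u}"
      using partial_coloring_extend_vertex[OF assms(1-5) less.prems assms(6) v] by blast
    have "card (verts G - (\<Union>i\<in>I. D i)) < card (verts G - (\<Union>i\<in>I. C i))"
      using v D(2) by (intro psubset_card_mono) auto
    then show ?thesis using D(1,3) by (rule less.hyps)
  qed
qed

lemma (in graph) exists_k_coloring_weights_between:
  fixes w :: "'a \<Rightarrow> real" and m t :: real
  assumes nonneg: "\<And>v. v \<in> verts G \<Longrightarrow> 0 \<le> w v" and le_m: "\<And>v. v \<in> verts G \<Longrightarrow> w v \<le> m"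
    and "0 \<le> t" "0 \<le> m" and "1 \<le> k" and deg: "2 * max_degree G \<le> k"
    and "k_coloring G c C" and total: "k * (t + m) + c * t \<le> sum w (verts G)"
  shows "\<exists>D. k_coloring G k D \<and>
    (\<forall>i\<in>{1..k}. sum w (D i) \<in> {t..2 * (sum w (verts G) / k) - t + m})"
proof -
  have "\<exists>D. partial_coloring G {1..k} D \<and> (\<forall>i\<in>{1..k}. sum w (D i) \<in> {t..t + m})"
  proof (cases "t = 0")
    case True
    then show ?thesis
      using \<open>0 \<le> m\<close>
      by (intro exI[of _ "\<lambda>_. {}"])
        (simp add: partial_coloring_def disjoint_family_on_def independent_set_def)
  next
    case False
    then show ?thesis
      using \<open>0 \<le> t\<close> \<open>0 \<le> m\<close> total
      by (intro exists_partial_coloring_weights_between[OF finite_verts assms(7) le_m]) auto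
  qed
  then obtain D where
    D: "partial_coloring G {1..k} D" "\<And>i. i \<in> {1..k} \<Longrightarrow> sum w (D i) \<in> {t..t + m}"
    by blast
  have "real k * t \<le> k * (t + m) + c * t"
    using \<open>0 \<le> t\<close> \<open>0 \<le> m\<close> by (simp add: algebra_simps)
  then have "t \<le> sum w (verts G) / k"
    using total \<open>1 \<le> k\<close> by (simp add: field_simps)
  then have "sum w (D i) \<in> {t..2 * (sum w (verts G) / k) - t + m}" if "i \<in> {1..k}" for i
    using D(2)[OF that] by auto
  with partial_coloring_extend[where w = w and I = "{1..k}" and C = D, OF nonneg le_m]
    D(1) deg \<open>1 \<le> k\<close>
  show ?thesis by (simp add: k_coloring_iff_partial_coloring)
qed

lemma (in graph) k_coloring_chromatic_number:
  "\<exists>C. k_coloring G (chromatic_number G) C"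
  unfolding chromatic_number_def by (rule LeastI_ex) (rule ex_k_coloring, unfold_locales)

lemma EQ1_if_weights_between:
  fixes w :: "'a \<Rightarrow> real" and t \<alpha> :: real
  assumes nonneg: "\<And>i v. i \<in> {1..k} \<Longrightarrow> v \<in> C i \<Longrightarrow> 0 \<le> w v" and "0 \<le> \<alpha>"
    and weights: "\<And>i. i \<in> {1..k} \<Longrightarrow> sum w (C i) \<in> {t..\<alpha> * t}"
  shows "EQ1 w \<alpha> k C"
  unfolding EQ1_def
proof (intro ballI impI)
  fix i j assume i: "i \<in> {1..k}" and j: "j \<in> {1..k}" and "C i \<noteq> {}"
  then obtain v where v: "v \<in> C i" by blast
  have "sum w (C i - {v}) \<le> sum w (C i)"
    using nonneg[OF i] by (cases "finite (C i)") (auto intro: sum_mono2)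
  also have "\<dots> \<le> \<alpha> * t"
    using weights[OF i] by simp
  also have "\<dots> \<le> \<alpha> * sum w (C j)"
    using weights[OF j] \<open>0 \<le> \<alpha>\<close> by (intro mult_left_mono) auto
  finally show "\<exists>v\<in>C i. sum w (C i - {v}) \<le> \<alpha> * sum w (C j)" using v by blast
qed

lemma max_class_weight_le_mult_min_class_weight:
  fixes \<epsilon> \<mu> t :: real
  assumes "0 < \<epsilon>" "\<epsilon> \<le> 0.1" "0 \<le> \<mu>" and t: "(1 + \<epsilon>) * t = (1 - \<epsilon>) * \<mu>"
  shows "2 * \<mu> - t + \<epsilon> * \<mu> \<le> (1 + 7 * \<epsilon>) * t"
proof -
  have "(2 + \<epsilon>) * (1 + \<epsilon>) \<le> (2 + 7 * \<epsilon>) * (1 - \<epsilon>)"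
    using mult_right_mono[OF assms(2), of \<epsilon>] assms(1) by (simp add: algebra_simps)
  then have "(2 + \<epsilon>) * (1 + \<epsilon>) * \<mu> \<le> (2 + 7 * \<epsilon>) * (1 - \<epsilon>) * \<mu>"
    using assms(3) by (rule mult_right_mono)
  also have "\<dots> = (2 + 7 * \<epsilon>) * ((1 + \<epsilon>) * t)" by (simp add: t)
  finally have "(1 + \<epsilon>) * ((2 + \<epsilon>) * \<mu>) \<le> (1 + \<epsilon>) * ((2 + 7 * \<epsilon>) * t)"
    by (simp add: mult_ac)
  then have "(2 + \<epsilon>) * \<mu> \<le> (2 + 7 * \<epsilon>) * t" using assms(1) by simp
  then show ?thesis by (simp add: algebra_simps)
qed

lemma total_piece_weight_budget:
  fixes \<epsilon> \<mu> t k c :: real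
  assumes t: "(1 + \<epsilon>) * t = (1 - \<epsilon>) * \<mu>" and "0 \<le> t" "c \<le> \<epsilon> * k"
  shows "k * (t + \<epsilon> * \<mu>) + c * t \<le> k * \<mu>"
proof -
  have "k * (t + \<epsilon> * \<mu>) + c * t \<le> k * (t + \<epsilon> * \<mu>) + \<epsilon> * k * t"
    using assms(2,3) by (intro add_left_mono mult_right_mono)
  also have "\<dots> = k * ((1 + \<epsilon>) * t + \<epsilon> * \<mu>)" by (simp add: algebra_simps)
  also have "\<dots> = k * \<mu>" unfolding t by (simp add: algebra_simps)
  finally show ?thesis .
qed

theorem theorem6:
  fixes G :: "('a, 'b) pre_digraph" and w :: "'a \<Rightarrow> real" and \<epsilon> :: real and k :: nat
  assumes "graph G"
    and "\<And>v. v \<in> verts G \<Longrightarrow> w v \<ge> 0"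
    and "0 < \<epsilon>" and "\<epsilon> \<le> 0.1"
    and "k \<ge> 1"
    and "real k \<ge> max (real (chromatic_number G) / \<epsilon>) (2 * real (max_degree G))"
    and "\<And>v. v \<in> verts G \<Longrightarrow> w v \<le> \<epsilon> * (sum w (verts G) / real k)"
  shows "\<exists>C. k_coloring G k C \<and> EQ1 w (1 + 7 * \<epsilon>) k C"
proof -
  interpret graph G by fact
  define \<mu> where "\<mu> = sum w (verts G) / k"
  define t where "t = \<mu> * (1 - \<epsilon>) / (1 + \<epsilon>)"
  have \<mu>: "0 \<le> \<mu>" using assms(2) by (simp add: \<mu>_def sum_nonneg)
  then have t: "0 \<le> t" "(1 + \<epsilon>) * t = (1 - \<epsilon>) * \<mu>"
    using assms(3,4) by (auto simp: t_def)
  have deg: "2 * max_degree G \<le> k" and chi: "chromatic_number G \<le> \<epsilon> * k"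
    using assms(3,6) by (auto simp: field_simps)
  have budget: "k * (t + \<epsilon> * \<mu>) + chromatic_number G * t \<le> sum w (verts G)"
    using total_piece_weight_budget[OF t(2,1) chi] assms(5) by (simp add: \<mu>_def)
  obtain C where C: "k_coloring G (chromatic_number G) C"
    using k_coloring_chromatic_number ..
  have "0 \<le> \<epsilon> * \<mu>" using \<mu> assms(3) by simp
  then obtain D where D: "k_coloring G k D"
      "\<And>i. i \<in> {1..k} \<Longrightarrow> sum w (D i) \<in> {t..2 * \<mu> - t + \<epsilon> * \<mu>}"
    using exists_k_coloring_weights_between[where w = w, OF assms(2,7) t(1) _ assms(5) deg C]
      budget unfolding \<mu>_def by blast
  have "EQ1 w (1 + 7 * \<epsilon>) k D"
  proof (rule EQ1_if_weights_between)
    show "0 \<le> w v" if "i \<in> {1..k}" "v \<in> D i" for i v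
      using assms(2) D(1) that unfolding k_coloring_def by blast
    show "sum w (D i) \<in> {t..(1 + 7 * \<epsilon>) * t}" if "i \<in> {1..k}" for i
      using max_class_weight_le_mult_min_class_weight[OF assms(3,4) \<mu> t(2)] D(2)[OF that] by auto
  qed (use assms(3) in simp)
  with D(1) show ?thesis by blast
qed

end
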